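(* Let $\boldsymbol{B}\in\mathbb{R}^{n\times n}$ be an index matrix with diagonal elements $b_i=B_{ii}$ (so $b_1\geq\cdots\geq b_n$), and let $\boldsymbol{g}=(g_1,\ldots,g_n)'\in R_{\boldsymbol{B}}$. For every $\varepsilon>0$ there exists $t(\varepsilon)>0$ such that $$\frac{\|\boldsymbol{g}(xt)-x^{\boldsymbol{B}}\boldsymbol{g}(t)\|}{|g_n(t)|}\leq\begin{cases}\varepsilon\,x^{b_1+\varepsilon}&\text{if } t\geq t(\varepsilon)\text{ and }x\geq1;\\ \varepsilon\,x^{b_n-\varepsilon}&\text{if } t\geq t(\varepsilon)\text{ and }t(\varepsilon)/t\leq x\leq1.\end{cases}$$
   Context: Here $\|\cdot\|$ is a norm on $\mathbb{R}^n$. Limit relations are as $t\to\infty$; measurability is Lebesgue. A real function is defined in a neighbourhood of infinity if its domain contains some $[t_0,\infty)$; it is eventually of constant sign if it is either strictly positive for all large $t$ or strictly negative for all large $t$. A rate vector of length $n$ is a column vector $\boldsymbol{g}=(g_1,\ldots,g_n)'$ of real-valued functions defined in a neighbourhood of infinity, each eventually of constant sign, with $g_{i+1}(t)=o(g_i(t))$ for every $i\in\{1,\ldots,n-1\}$; $o(g_n(t))$ means $o(|g_n(t)|)$, componentwise for vectors. For a square matrix $\boldsymbol{B}$ and $x>0$, $x^{\boldsymbol{B}}=\exp\{(\log x)\boldsymbol{B}\}$. An index matrix is an upper triangular $\boldsymbol{B}\in\mathbb{R}^{n\times n}$ whose diagonal elements are non-increasing and all of whose eigenvalues, except possibly the smallest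 one, have geometric multiplicity one. A rate vector $\boldsymbol{g}$ is regularly varying with index matrix $\boldsymbol{B}$, written $\boldsymbol{g}\in R_{\boldsymbol{B}}$, if $\boldsymbol{g}$ is measurable and $\boldsymbol{g}(xt)=x^{\boldsymbol{B}}\boldsymbol{g}(t)+o(g_n(t))$ for every $x\in(0,\infty)$. *)

theory Defs
  imports "HOL-Analysis.Analysis" "HOL-Library.Landau_Symbols"
begin

text \<open>
  Vectors of length \<open>n \<ge> 1\<close> are elements of \<open>real ^ 'n\<close>, where the finite linear order
  \<open>'n\<close> plays the role of the index set \<open>{1 < ... < n}\<close>.
\<close>

definition first_ix :: "'n::{finite,linorder}" where
  "first_ix = Min UNIV"

definition last_ix :: "'n::{finite,linorder}" where
  "last_ix = Max UNIV"

text \<open>\<open>succ_ix i j\<close> says \<open>j = i + 1\<close>.\<close>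

definition succ_ix :: "'n::{finite,linorder} \<Rightarrow> 'n \<Rightarrow> bool" where
  "succ_ix i j \<longleftrightarrow> i < j \<and> \<not> (\<exists>k. i < k \<and> k < j)"

definition is_norm :: "('a::real_vector \<Rightarrow> real) \<Rightarrow> bool" where
  "is_norm N \<longleftrightarrow>
     (\<forall>x. 0 \<le> N x) \<and>
     (\<forall>x. N x = 0 \<longleftrightarrow> x = 0) \<and>
     (\<forall>c x. N (c *\<^sub>R x) = \<bar>c\<bar> * N x) \<and>
     (\<forall>x y. N (x + y) \<le> N x + N y)"

text \<open>
  The library operations \<open>*\<close>, \<open>^\<close> and hence \<open>exp\<close> would act componentwise on
  \<open>real ^ 'n ^ 'n\<close>; powers here are taken with respect to the matrix product \<open>**\<close>.
\<close>

definition matrix_pow :: "real ^ 'n ^ 'n \<Rightarrow> nat \<Rightarrow> real ^ 'n ^ 'n" where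
  "matrix_pow A k = (((**) A) ^^ k) (mat 1)"

definition matrix_exp :: "real ^ 'n ^ 'n \<Rightarrow> real ^ 'n ^ 'n" where
  "matrix_exp A = (\<Sum>k. (1 / fact k) *\<^sub>R matrix_pow A k)"

definition matrix_powr :: "real \<Rightarrow> real ^ 'n ^ 'n \<Rightarrow> real ^ 'n ^ 'n" where
  "matrix_powr x B = matrix_exp (ln x *\<^sub>R B)"

definition eigenspace :: "real ^ 'n ^ 'n \<Rightarrow> real \<Rightarrow> (real ^ 'n) set" where
  "eigenspace B c = {v. B *v v = c *\<^sub>R v}"

text \<open>
  Only real eigenvalues are considered: a real upper triangular matrix has no others.
\<close>

definition is_eigenvalue :: "real ^ 'n ^ 'n \<Rightarrow> real \<Rightarrow> bool" where
  "is_eigenvalue B c \<longleftrightarrow> (\<exists>v. v \<noteq> 0 \<and> B *v v = c *\<^sub>R v)"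

definition geometric_multiplicity :: "real ^ 'n ^ 'n \<Rightarrow> real \<Rightarrow> nat" where
  "geometric_multiplicity B c = dim (eigenspace B c)"

definition upper_triangular_matrix :: "real ^ 'n::{finite,linorder} ^ 'n::{finite,linorder} \<Rightarrow> bool" where
  "upper_triangular_matrix B \<longleftrightarrow> (\<forall>i j. j < i \<longrightarrow> B $ i $ j = 0)"

text \<open>An eigenvalue is not the smallest one iff some eigenvalue lies strictly below it.\<close>

definition index_matrix :: "real ^ 'n::{finite,linorder} ^ 'n::{finite,linorder} \<Rightarrow> bool" where
  "index_matrix B \<longleftrightarrow>
     upper_triangular_matrix B \<and>
     (\<forall>i j. i \<le> j \<longrightarrow> B $ j $ j \<le> B $ i $ i) \<and>
     (\<forall>c. is_eigenvalue B c \<and> (\<exists>d. is_eigenvalue B d \<and> d < c)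
            \<longrightarrow> geometric_multiplicity B c = 1)"

definition eventually_constant_sign :: "(real \<Rightarrow> real) \<Rightarrow> bool" where
  "eventually_constant_sign f \<longleftrightarrow>
     (\<forall>\<^sub>F t in at_top. f t > 0) \<or> (\<forall>\<^sub>F t in at_top. f t < 0)"

text \<open>
  A function with domain \<open>D\<close> is a pair of \<open>D\<close> and a total function whose values off \<open>D\<close>
  are arbitrary.  For a vector of functions, \<open>D\<close> is the intersection of the domains of the
  components.
\<close>

definition nbhd_of_infinity :: "real set \<Rightarrow> bool" where
  "nbhd_of_infinity D \<longleftrightarrow> (\<exists>t0. {t0..} \<subseteq> D)"

definition rate_vector :: "real set \<Rightarrow> (real \<Rightarrow> real ^ 'n::{finite,linorder}) \<Rightarrow> bool" where
  "rate_vector D g \<longleftrightarrow>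
     nbhd_of_infinity D \<and>
     (\<forall>i. eventually_constant_sign (\<lambda>t. g t $ i)) \<and>
     (\<forall>i j. succ_ix i j \<longrightarrow> (\<lambda>t. g t $ j) \<in> o[at_top](\<lambda>t. g t $ i))"

definition regularly_varying ::
  "real ^ 'n::{finite,linorder} ^ 'n::{finite,linorder} \<Rightarrow> real set \<Rightarrow> (real \<Rightarrow> real ^ 'n::{finite,linorder}) \<Rightarrow> bool" where
  "regularly_varying B D g \<longleftrightarrow>
     rate_vector D g \<and>
     D \<in> sets lebesgue \<and> g \<in> borel_measurable (lebesgue_on D) \<and>
     (\<forall>x>0. \<forall>i. (\<lambda>t. (g (x * t) - matrix_powr x B *v g t) $ i)
                   \<in> o[at_top](\<lambda>t. \<bar>g t $ last_ix\<bar>))"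

end

theory Submission
  imports Defs
begin

text \<open>
  Write \<open>r(x, t) = g(x t) - x\<^sup>B g(t)\<close> and \<open>\<phi>(t) = \<bar>g\<^sub>n(t)\<bar>\<close>. The last row of \<open>x\<^sup>B\<close> is \<open>x\<close> to the power \<open>b\<^sub>n\<close>, so
  \<open>\<phi>\<close> is regularly varying with index \<open>b\<^sub>n\<close>, and \<open>r(x y, t) = r(x, y t) + x\<^sup>B r(y, t)\<close>. From this identity and
  measurability, pointwise convergence \<open>r(x, t) = o(\<phi>(t))\<close> is uniform in \<open>x \<in> [1, 2]\<close>, first for the
  logarithm of \<open>\<phi>\<close> and then for \<open>r\<close>. Writing \<open>x = y q\<^sup>k\<close> with \<open>q = 2\<close> or \<open>q = 1/2\<close> and inducting on
  \<open>k\<close> through \<open>r(x q, t) = r(x, q t) + x\<^sup>B r(q, t)\<close> gives the bounds for all \<open>x\<close>: the factor \<open>\<phi>(q t)/\<phi>(t)\<close>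
  is strictly smaller than \<open>q\<close> raised to the target exponent, which leaves room for the second term.
\<close>

subsection \<open>The matrix exponential as a flow\<close>

lemma matrix_pow_Suc: "matrix_pow A (Suc k) = A ** matrix_pow A k"
  by (simp add: matrix_pow_def)

lemma matrix_pow_scaleR: "matrix_pow (c *\<^sub>R A) k = c ^ k *\<^sub>R matrix_pow A k"
  by (induction k)
     (auto simp: matrix_pow_def matrix_matrix_mult_def vec_eq_iff sum_distrib_left algebra_simps)

text \<open>\<open>M\<close> dominates every row sum of \<open>A\<close>, so each further factor
  \<open>A\<close> costs at most a factor \<open>M\<close>. The bound compares the entrywise
  exponential series with that of \<open>exp (M * \<bar>u\<bar>)\<close>, whence convergence for all
  \<open>u\<close>.\<close>

lemma matrix_pow_entry_bound:
  fixes A :: "real ^ 'n ^ 'n"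
  assumes "(\<Sum>i\<in>UNIV. \<Sum>j\<in>UNIV. \<bar>A $ i $ j\<bar>) \<le> M"
  shows "\<bar>matrix_pow A k $ i $ j\<bar> \<le> M ^ k"
proof (induction k arbitrary: i j)
  case 0
  show ?case by (simp add: matrix_pow_def mat_def)
next
  case (Suc k)
  have M0: "0 \<le> M"
    using assms by (meson abs_ge_zero order_trans sum_nonneg)
  have row: "(\<Sum>l\<in>UNIV. \<bar>A $ i $ l\<bar>) \<le> M"
    using assms member_le_sum[of i UNIV "\<lambda>i. \<Sum>j\<in>UNIV. \<bar>A $ i $ j\<bar>"]
    by (force simp: sum_nonneg intro: order_trans)
  have "\<bar>matrix_pow A (Suc k) $ i $ j\<bar> \<le> (\<Sum>l\<in>UNIV. \<bar>A $ i $ l * matrix_pow A k $ l $ j\<bar>)"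
    by (simp add: matrix_pow_Suc matrix_matrix_mult_def sum_abs)
  also have "\<dots> \<le> (\<Sum>l\<in>UNIV. \<bar>A $ i $ l\<bar> * M ^ k)"
    by (intro sum_mono) (simp add: abs_mult mult_left_mono Suc.IH)
  also have "\<dots> \<le> M * M ^ k"
    using row M0 by (simp add: sum_distrib_right[symmetric] mult_right_mono)
  finally show ?case by simp
qed

lemma summable_matrix_pow_entry:
  fixes A :: "real ^ 'n ^ 'n"
  shows "summable (\<lambda>k. matrix_pow A k $ i $ j / fact k * u ^ k)"
proof (rule summable_comparison_test')
  define M where "M = (\<Sum>i\<in>UNIV. \<Sum>j\<in>UNIV. \<bar>A $ i $ j\<bar>)"
  show "summable (\<lambda>k. (M * \<bar>u\<bar>) ^ k /\<^sub>R fact k)"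
    by (rule summable_exp_generic)
  show "norm (matrix_pow A k $ i $ j / fact k * u ^ k) \<le> (M * \<bar>u\<bar>) ^ k /\<^sub>R fact k"
    if "k \<ge> 0" for k
    using matrix_pow_entry_bound[of A M k i j]
    by (simp add: M_def abs_mult power_abs power_mult_distrib divide_simps mult_right_mono)
qed

lemma matrix_exp_scaleR_entry:
  fixes A :: "real ^ 'n ^ 'n"
  shows "matrix_exp (u *\<^sub>R A) $ i $ j = (\<Sum>k. matrix_pow A k $ i $ j / fact k * u ^ k)"
proof -
  have "(\<lambda>k. (1 / fact k) *\<^sub>R matrix_pow (u *\<^sub>R A) k)
      sums (\<chi> i j. \<Sum>k. matrix_pow A k $ i $ j / fact k * u ^ k)"
    using summable_sums[OF summable_matrix_pow_entry]
    by (auto simp: sums_def matrix_pow_scaleR mult_ac intro!: vec_tendstoI)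
  then show ?thesis
    unfolding matrix_exp_def by (simp add: sums_iff)
qed

text \<open>Termwise differentiation: \<open>diffs\<close> shifts the coefficients, which cancels
  the new factor of the factorial and leaves \<open>matrix_pow A (Suc k)\<close>. One factor
  \<open>A\<close> then splits off, and the finite row sum is exchanged with the series.\<close>

lemma matrix_exp_entry_has_derivative:
  fixes A :: "real ^ 'n ^ 'n"
  shows "((\<lambda>u. matrix_exp (u *\<^sub>R A) $ i $ j) has_real_derivative
           (A ** matrix_exp (u *\<^sub>R A)) $ i $ j) (at u)"
proof -
  have "diffs (\<lambda>k. matrix_pow A k $ i $ j / fact k) k * u ^ k
      = (\<Sum>l\<in>UNIV. A $ i $ l * (matrix_pow A k $ l $ j / fact k * u ^ k))" for k
  proof -
    have "diffs (\<lambda>k. matrix_pow A k $ i $ j / fact k) k = matrix_pow A (Suc k) $ i $ j / fact k"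
      by (simp add: diffs_def del: of_nat_Suc)
    then show ?thesis
      by (simp add: matrix_pow_Suc matrix_matrix_mult_def sum_distrib_left sum_distrib_right
          sum_divide_distrib mult_ac)
  qed
  moreover have "(\<Sum>k. \<Sum>l\<in>UNIV. A $ i $ l * (matrix_pow A k $ l $ j / fact k * u ^ k))
      = (\<Sum>l\<in>UNIV. A $ i $ l * (\<Sum>k. matrix_pow A k $ l $ j / fact k * u ^ k))"
    by (subst suminf_sum, intro summable_mult summable_matrix_pow_entry)
       (intro sum.cong refl suminf_mult summable_matrix_pow_entry)
  ultimately have "(\<Sum>k. diffs (\<lambda>k. matrix_pow A k $ i $ j / fact k) k * u ^ k)
      = (A ** matrix_exp (u *\<^sub>R A)) $ i $ j"
    by (simp add: matrix_matrix_mult_def matrix_exp_scaleR_entry)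
  then show ?thesis
    using termdiffs_strong_converges_everywhere[OF summable_matrix_pow_entry, of A i j u]
    by (simp add: matrix_exp_scaleR_entry)
qed

text \<open>Later arguments reach the exponential only through this differential equation and the
  value at \<open>0\<close>.\<close>

lemma matrix_exp_flow:
  fixes A :: "real ^ 'n ^ 'n"
  shows "((\<lambda>u. (matrix_exp (u *\<^sub>R A) *v v) $ i) has_real_derivative
           (A *v (matrix_exp (u *\<^sub>R A) *v v)) $ i) (at u)"
proof -
  have "((\<lambda>u. (matrix_exp (u *\<^sub>R A) *v v) $ i) has_real_derivative
           ((A ** matrix_exp (u *\<^sub>R A)) *v v) $ i) (at u)"
    unfolding matrix_vector_mult_def
    by (auto intro!: derivative_eq_intros matrix_exp_entry_has_derivative)
  then show ?thesis
    by (simp add: matrix_vector_mul_assoc)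
qed

lemma matrix_exp_0: "matrix_exp (0 :: real ^ 'n ^ 'n) = mat 1"
proof -
  \<comment> \<open>Writing the zero matrix as a multiple makes the entrywise power series
    applicable at \<open>u = 0\<close>, where only the constant term remains.\<close>
  have "matrix_exp (0 *\<^sub>R (0 :: real ^ 'n ^ 'n)) $ i $ j = mat 1 $ i $ j" for i j
    unfolding matrix_exp_scaleR_entry by (subst powser_zero) (simp add: matrix_pow_def)
  then show ?thesis
    by (simp add: vec_eq_iff)
qed

subsection \<open>Growth of triangular flows\<close>

text \<open>Geometrically increasing weights \<open>d\<close> make the off-diagonal part of \<open>B\<close> negligible in the
  quadratic form \<open>\<Sum>d\<^sub>i w\<^sub>i\<^sup>2\<close>, whose logarithmic derivative along \<open>w' = B w\<close> is then governed by the
  diagonal of \<open>B\<close>.\<close>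

lemma triangular_weights:
  fixes B :: "real ^ 'n::{finite,linorder} ^ 'n::{finite,linorder}"
  assumes tri: "upper_triangular_matrix B" and \<eta>: "\<eta> > 0"
  obtains d :: "'n \<Rightarrow> real" where "\<And>i. d i \<ge> 1"
    "\<And>w :: real ^ 'n::_. \<bar>\<Sum>i\<in>UNIV. d i * w $ i * ((B *v w) $ i - B $ i $ i * w $ i)\<bar>
            \<le> \<eta> * (\<Sum>i\<in>UNIV. d i * (w $ i)\<^sup>2)"
proof -
  define M where "M = (\<Sum>i\<in>UNIV. \<Sum>j\<in>UNIV. \<bar>B $ i $ j\<bar>)"
  \<comment> \<open>This choice gives
    \<open>M / \<tau> = M * \<eta> / (\<eta> + M) \<le> \<eta>\<close>. The weights are powers
    \<open>\<tau> ^ (2 * r i)\<close>, with \<open>r i\<close> the rank of \<open>i\<close> counted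
    from \<open>0\<close>.\<close>
  define \<tau> where "\<tau> = 1 + M / \<eta>"
  define r where "r i = card {..<i}" for i :: 'n
  have M0: "M \<ge> 0" unfolding M_def by (intro sum_nonneg) auto
  have \<tau>1: "\<tau> \<ge> 1" using M0 \<eta> by (simp add: \<tau>_def)
  have rless: "r i < r j" if "i < j" for i j
    unfolding r_def using that by (intro psubset_card_mono) auto
  show ?thesis
  proof (rule that[of "\<lambda>i. \<tau> ^ (2 * r i)"])
    show "\<tau> ^ (2 * r i) \<ge> 1" for i using \<tau>1 by simp
    fix w :: "real ^ 'n::_"
    define Q where "Q = (\<Sum>i\<in>UNIV. \<tau> ^ (2 * r i) * (w $ i)\<^sup>2)"
    have entry: "\<tau> ^ r i * \<bar>w $ i\<bar> \<le> sqrt Q" for i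
    proof (rule real_le_rsqrt)
      have "(\<tau> ^ r i * \<bar>w $ i\<bar>)\<^sup>2 = \<tau> ^ (2 * r i) * (w $ i)\<^sup>2"
        by (simp add: power_mult_distrib power_mult[symmetric] mult.commute)
      also have "\<dots> \<le> Q"
        unfolding Q_def by (rule member_le_sum) auto
      finally show "(\<tau> ^ r i * \<bar>w $ i\<bar>)\<^sup>2 \<le> Q" .
    qed
    have Q0: "Q \<ge> 0" unfolding Q_def by (intro sum_nonneg) auto
    \<comment> \<open>Above the diagonal \<open>r j \<ge> r i + 1\<close>, so splitting the weight
      evenly between the two coordinates leaves a spare factor \<open>1 / \<tau>\<close>.\<close>
    have pair: "\<tau> ^ (2 * r i) * \<bar>w $ i\<bar> * \<bar>w $ j\<bar> \<le> Q / \<tau>" if "i < j" for i j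
    proof -
      have "\<tau> ^ (2 * r i) = \<tau> ^ r i * \<tau> ^ r i"
        by (simp add: mult_2 power_add)
      then have "\<tau> * (\<tau> ^ (2 * r i) * \<bar>w $ i\<bar> * \<bar>w $ j\<bar>)
          = (\<tau> ^ r i * \<bar>w $ i\<bar>) * (\<tau> ^ Suc (r i) * \<bar>w $ j\<bar>)"
        by (simp only: power_Suc mult_ac)
      also have "\<dots> \<le> (\<tau> ^ r i * \<bar>w $ i\<bar>) * (\<tau> ^ r j * \<bar>w $ j\<bar>)"
        using rless[OF that] \<tau>1
        by (intro mult_left_mono mult_right_mono power_increasing) auto
      also have "\<dots> \<le> sqrt Q * sqrt Q"
        using \<tau>1 Q0 by (intro mult_mono entry) auto
      finally show ?thesis using \<tau>1 Q0 by (simp add: field_simps)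
    qed
    have "(B *v w) $ i - B $ i $ i * w $ i = (\<Sum>j\<in>UNIV - {i}. B $ i $ j * w $ j)" for i
      by (simp add: matrix_vector_mult_def sum.remove[of UNIV i])
    then have "\<bar>\<Sum>i\<in>UNIV. \<tau> ^ (2 * r i) * w $ i * ((B *v w) $ i - B $ i $ i * w $ i)\<bar>
        = \<bar>\<Sum>i\<in>UNIV. \<Sum>j\<in>UNIV - {i}. \<tau> ^ (2 * r i) * w $ i * (B $ i $ j * w $ j)\<bar>"
      by (simp add: sum_distrib_left)
    also have "\<dots> \<le> (\<Sum>i\<in>UNIV. \<Sum>j\<in>UNIV - {i}. \<bar>\<tau> ^ (2 * r i) * w $ i * (B $ i $ j * w $ j)\<bar>)"
      by (intro order_trans[OF sum_abs] sum_mono sum_abs)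
    also have "\<dots> \<le> (\<Sum>i\<in>UNIV. \<Sum>j\<in>UNIV - {i}. \<bar>B $ i $ j\<bar> * (Q / \<tau>))"
    proof (intro sum_mono)
      fix i j :: 'n assume j: "j \<in> UNIV - {i}"
      show "\<bar>\<tau> ^ (2 * r i) * w $ i * (B $ i $ j * w $ j)\<bar> \<le> \<bar>B $ i $ j\<bar> * (Q / \<tau>)"
      proof (cases "i < j")
        case True
        have "\<bar>\<tau> ^ (2 * r i) * w $ i * (B $ i $ j * w $ j)\<bar>
            = \<bar>B $ i $ j\<bar> * (\<tau> ^ (2 * r i) * \<bar>w $ i\<bar> * \<bar>w $ j\<bar>)"
          using \<tau>1 by (simp add: abs_mult)
        then show ?thesis
          using mult_left_mono[OF pair[OF True], of "\<bar>B $ i $ j\<bar>"] by simp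
      next
        case False
        then have "B $ i $ j = 0"
          using tri j by (auto simp: upper_triangular_matrix_def not_less order.order_iff_strict)
        then show ?thesis by simp
      qed
    qed
    also have "\<dots> \<le> (\<Sum>i\<in>UNIV. \<Sum>j\<in>UNIV. \<bar>B $ i $ j\<bar> * (Q / \<tau>))"
      using \<tau>1 Q0 by (intro sum_mono sum_mono2) auto
    also have "\<dots> = M * (Q / \<tau>)"
      by (simp only: M_def sum_distrib_right)
    also have "\<dots> = (M / \<tau>) * Q" by simp
    also have "\<dots> \<le> \<eta> * Q"
      using \<eta> M0 Q0 by (intro mult_right_mono) (simp_all add: \<tau>_def field_simps add_nonneg_pos)
    finally show "\<bar>\<Sum>i\<in>UNIV. \<tau> ^ (2 * r i) * w $ i * ((B *v w) $ i - B $ i $ i * w $ i)\<bar>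
        \<le> \<eta> * (\<Sum>i\<in>UNIV. \<tau> ^ (2 * r i) * (w $ i)\<^sup>2)"
      by (simp add: Q_def)
  qed
qed

lemma norm_vec_power2: "(norm (v :: real ^ 'n))\<^sup>2 = (\<Sum>i\<in>UNIV. (v $ i)\<^sup>2)"
  by (simp add: norm_vec_def L2_set_def sum_nonneg)

text \<open>Energy estimate: \<open>Q (w u)\<close> has derivative \<open>2 * E (w u)\<close>, and
  \<open>E\<close> lies between \<open>(b - \<eta>) * Q\<close> and \<open>(c + \<eta>) * Q\<close>.
  The statement covers arbitrary solutions, not only exponentials, so that it also yields uniqueness
  for the differential equation.\<close>

lemma triangular_flow_bounds:
  fixes B :: "real ^ 'n::{finite,linorder} ^ 'n::{finite,linorder}"
  assumes tri: "upper_triangular_matrix B" and \<eta>: "\<eta> > 0"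
    and lo: "\<And>i. b \<le> B $ i $ i" and hi: "\<And>i. B $ i $ i \<le> c"
  obtains C where "C > 0"
    "\<And>w u. (\<And>u i. ((\<lambda>u. w u $ i) has_real_derivative (B *v w u) $ i) (at u)) \<Longrightarrow> 0 \<le> u
        \<Longrightarrow> norm (w u) \<le> C * exp ((c + \<eta>) * u) * norm (w 0)"
    "\<And>w u. (\<And>u i. ((\<lambda>u. w u $ i) has_real_derivative (B *v w u) $ i) (at u)) \<Longrightarrow> u \<le> 0
        \<Longrightarrow> norm (w u) \<le> C * exp ((b - \<eta>) * u) * norm (w 0)"
proof -
  obtain d where d1: "\<And>i. d i \<ge> 1"
    and d: "\<And>w. \<bar>\<Sum>i\<in>UNIV. d i * w $ i * ((B *v w) $ i - B $ i $ i * w $ i)\<bar>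
            \<le> \<eta> * (\<Sum>i\<in>UNIV. d i * (w $ i)\<^sup>2)"
    by (rule triangular_weights[OF tri \<eta>]) (rule that)
  define Q where "Q v = (\<Sum>i\<in>UNIV. d i * (v $ i)\<^sup>2)" for v :: "real ^ 'n::_"
  define E where "E v = (\<Sum>i\<in>UNIV. d i * v $ i * (B *v v) $ i)" for v :: "real ^ 'n::_"
  define S where "S = (\<Sum>i\<in>UNIV. d i)"
  have d0: "d i \<ge> 0" for i using d1[of i] by linarith
  have S: "S > 0" unfolding S_def
    by (rule sum_pos) (use d1 in \<open>auto intro: less_le_trans[OF zero_less_one]\<close>)
  have normQ: "(norm v)\<^sup>2 \<le> Q v" for v
    unfolding norm_vec_power2 Q_def
    using mult_right_mono[OF d1 zero_le_power2] by (intro sum_mono) simp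
  have Qnorm: "Q v \<le> S * (norm v)\<^sup>2" for v
    unfolding Q_def S_def sum_distrib_right
    by (intro sum_mono mult_left_mono d0)
      (simp add: component_le_norm_cart flip: abs_le_square_iff)
  have E_eq: "E v = (\<Sum>i\<in>UNIV. d i * (v $ i)\<^sup>2 * B $ i $ i)
      + (\<Sum>i\<in>UNIV. d i * v $ i * ((B *v v) $ i - B $ i $ i * v $ i))" for v
    by (simp add: E_def algebra_simps power2_eq_square flip: sum.distrib sum_subtractf)
  have E_up: "E v \<le> (c + \<eta>) * Q v" for v
  proof -
    have "(\<Sum>i\<in>UNIV. d i * (v $ i)\<^sup>2 * B $ i $ i) \<le> Q v * c"
      unfolding Q_def sum_distrib_right by (intro sum_mono mult_left_mono hi) (simp add: d0)
    with d[of v] show ?thesis by (simp add: E_eq Q_def[symmetric] algebra_simps)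
  qed
  have E_lo: "(b - \<eta>) * Q v \<le> E v" for v
  proof -
    have "Q v * b \<le> (\<Sum>i\<in>UNIV. d i * (v $ i)\<^sup>2 * B $ i $ i)"
      unfolding Q_def sum_distrib_right by (intro sum_mono mult_left_mono lo) (simp add: d0)
    with d[of v] show ?thesis by (simp add: E_eq Q_def[symmetric] algebra_simps)
  qed
  \<comment> \<open>Dividing out the expected growth \<open>exp (2 * k * u)\<close> makes the sign
    of the derivative that of \<open>E - k * Q\<close>: nonpositive for
    \<open>k = c + \<eta>\<close>, nonnegative for \<open>k = b - \<eta>\<close>.\<close>
  define F where "F w k u = Q (w u) * exp (- 2 * k * u)" for w :: "real \<Rightarrow> real ^ 'n::_" and k u
  have F_deriv: "(F w k has_real_derivative 2 * (E (w u) - k * Q (w u)) * exp (- 2 * k * u)) (at u)"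
    if "\<And>u i. ((\<lambda>u. w u $ i) has_real_derivative (B *v w u) $ i) (at u)" for w k u
    unfolding F_def Q_def E_def
    by (rule derivative_eq_intros that refl)+
       (simp add: algebra_simps sum_distrib_left)
  have conclude: "norm (w u) \<le> sqrt S * exp (k * u) * norm (w 0)" if "F w k u \<le> F w k 0" for w k u
  proof (rule power2_le_imp_le)
    have "(norm (w u))\<^sup>2 \<le> Q (w u)" by (rule normQ)
    also have "Q (w u) \<le> Q (w 0) * exp (2 * k * u)"
      using that by (simp add: F_def exp_minus field_simps)
    also have "\<dots> \<le> S * (norm (w 0))\<^sup>2 * exp (2 * k * u)"
      by (intro mult_right_mono Qnorm) auto
    also have "\<dots> = (sqrt S * exp (k * u) * norm (w 0))\<^sup>2"
      using S by (simp add: power_mult_distrib exp_double[symmetric] mult_ac)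
    finally show "(norm (w u))\<^sup>2 \<le> (sqrt S * exp (k * u) * norm (w 0))\<^sup>2" .
    show "0 \<le> sqrt S * exp (k * u) * norm (w 0)" using S by simp
  qed
  show ?thesis
  proof (rule that[of "sqrt S"])
    show "sqrt S > 0" using S by simp
  next
    fix w u assume w: "\<And>u i. ((\<lambda>u. w u $ i) has_real_derivative (B *v w u) $ i) (at u)"
      and u: "(0::real) \<le> u"
    show "norm (w u) \<le> sqrt S * exp ((c + \<eta>) * u) * norm (w 0)"
      by (rule conclude, rule DERIV_nonpos_imp_nonincreasing[OF u])
         (use F_deriv[OF w] E_up in \<open>force intro: mult_nonpos_nonneg mult_nonneg_nonpos\<close>)
  next
    fix w u assume w: "\<And>u i. ((\<lambda>u. w u $ i) has_real_derivative (B *v w u) $ i) (at u)"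
      and u: "u \<le> (0::real)"
    show "norm (w u) \<le> sqrt S * exp ((b - \<eta>) * u) * norm (w 0)"
      by (rule conclude, rule DERIV_nonneg_imp_nondecreasing[OF u])
         (use F_deriv[OF w] E_lo in \<open>force intro: mult_nonneg_nonneg\<close>)
  qed
qed

lemma triangular_exp_add:
  fixes B :: "real ^ 'n::{finite,linorder} ^ 'n::{finite,linorder}"
  assumes tri: "upper_triangular_matrix B"
  shows "matrix_exp ((u + v) *\<^sub>R B) *v x = matrix_exp (u *\<^sub>R B) *v (matrix_exp (v *\<^sub>R B) *v x)"
proof -
  \<comment> \<open>A crude bound on the diagonal is enough, since the growth rate is irrelevant
    when the initial value is zero.\<close>
  define M where "M = (\<Sum>i\<in>UNIV. \<bar>B $ i $ i\<bar>)"
  have M: "\<bar>B $ i $ i\<bar> \<le> M" for i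
    unfolding M_def by (rule member_le_sum) auto
  have "- M \<le> B $ i $ i" "B $ i $ i \<le> M" for i using M[of i] by auto
  then obtain C where C: "C > 0"
    "\<And>w u. (\<And>u i. ((\<lambda>u. w u $ i) has_real_derivative (B *v w u) $ i) (at u)) \<Longrightarrow> 0 \<le> u
        \<Longrightarrow> norm (w u) \<le> C * exp ((M + 1) * u) * norm (w 0)"
    "\<And>w u. (\<And>u i. ((\<lambda>u. w u $ i) has_real_derivative (B *v w u) $ i) (at u)) \<Longrightarrow> u \<le> 0
        \<Longrightarrow> norm (w u) \<le> C * exp ((- M - 1) * u) * norm (w 0)"
    using triangular_flow_bounds[OF tri zero_less_one] by metis
  \<comment> \<open>Both sides solve \<open>w' = B w\<close>; the growth bounds force a solution vanishing at \<open>0\<close> to vanish.\<close>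
  define w where "w u = matrix_exp ((u + v) *\<^sub>R B) *v x
      - matrix_exp (u *\<^sub>R B) *v (matrix_exp (v *\<^sub>R B) *v x)" for u
  have w: "((\<lambda>u. w u $ i) has_real_derivative (B *v w u) $ i) (at u)" for u i
    unfolding w_def matrix_vector_mult_diff_distrib vector_minus_component
    by (intro DERIV_diff matrix_exp_flow matrix_exp_flow[where u = "u + v", unfolded DERIV_shift])
  have w0: "w 0 = 0" by (simp add: w_def matrix_exp_0)
  have "norm (w u) \<le> 0"
    using C(2,3)[OF w, of u] by (cases "0 \<le> u") (auto simp: w0)
  then show ?thesis by (simp add: w_def)
qed

section \<open>Real powers of a triangular matrix\<close>

lemma le_last_ix [simp]: "i \<le> last_ix"
  by (simp add: last_ix_def)

lemma first_ix_le [simp]: "first_ix \<le> i"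
  by (simp add: first_ix_def)

lemma triangular_mult_last:
  assumes "upper_triangular_matrix B"
  shows "(B *v v) $ last_ix = B $ last_ix $ last_ix * v $ last_ix"
proof -
  have "B $ last_ix $ j * v $ j = 0" if "j \<noteq> last_ix" for j
    using assms that le_last_ix[of j]
    by (auto simp: upper_triangular_matrix_def order.order_iff_strict)
  then have "(\<Sum>j\<in>UNIV - {last_ix}. B $ last_ix $ j * v $ j) = 0"
    by (intro sum.neutral) auto
  then show ?thesis
    by (simp add: matrix_vector_mult_def sum.remove[of UNIV last_ix])
qed

text \<open>The last coordinate of the flow decouples and solves the scalar equation
  \<open>f' = b * f\<close>, so its product with \<open>exp (- b * u)\<close> is constant. This
  reduces the behaviour of the last component of \<open>g\<close> to scalar regular
  variation.\<close>

lemma triangular_powr_last: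
  assumes tri: "upper_triangular_matrix B" and x: "x > 0"
  shows "(matrix_powr x B *v v) $ last_ix = x powr (B $ last_ix $ last_ix) * v $ last_ix"
proof -
  define b where "b = B $ last_ix $ last_ix"
  define f where "f u = (matrix_exp (u *\<^sub>R B) *v v) $ last_ix * exp (- b * u)" for u
  have "(f has_real_derivative 0) (at u)" for u
    unfolding f_def
    by (rule derivative_eq_intros matrix_exp_flow refl)+
       (simp add: triangular_mult_last[OF tri] b_def)
  then have "f (ln x) = f 0" by (rule DERIV_isconst_all[rule_format])
  then show ?thesis
    using x by (simp add: f_def matrix_exp_0 matrix_powr_def b_def powr_def exp_minus field_simps)
qed

lemma matrix_powr_one [simp]: "matrix_powr 1 B *v v = v"
  by (simp add: matrix_powr_def matrix_exp_0)

lemma triangular_powr_mult: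
  assumes "upper_triangular_matrix B" "x > 0" "y > 0"
  shows "matrix_powr (x * y) B *v v = matrix_powr x B *v (matrix_powr y B *v v)"
  using assms by (simp add: matrix_powr_def ln_mult triangular_exp_add)

lemma continuous_on_matrix_powr: "continuous_on {0<..} (\<lambda>x. matrix_powr x B *v v)"
proof -
  have "continuous_on UNIV (\<lambda>u. (matrix_exp (u *\<^sub>R B) *v v) $ i)" for i
    using matrix_exp_flow by (auto intro!: continuous_at_imp_continuous_on DERIV_isCont)
  then have *: "continuous_on UNIV (\<lambda>u. matrix_exp (u *\<^sub>R B) *v v)"
    using continuous_on_vec_lambda[of UNIV "\<lambda>i u. (matrix_exp (u *\<^sub>R B) *v v) $ i"] by simp
  show ?thesis unfolding matrix_powr_def
    by (rule continuous_on_compose2[OF *]) (auto intro!: continuous_intros)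
qed

text \<open>Substituting \<open>u = ln x\<close> turns exponential growth of the flow into powers of
  \<open>x\<close>, with forward time for \<open>x \<ge> 1\<close> and backward time for
  \<open>x \<le> 1\<close>.\<close>

lemma triangular_powr_bounds:
  fixes B :: "real ^ 'n::{finite,linorder} ^ 'n::{finite,linorder}"
  assumes tri: "upper_triangular_matrix B" and \<eta>: "\<eta> > 0"
    and lo: "\<And>i. b \<le> B $ i $ i" and hi: "\<And>i. B $ i $ i \<le> c"
  obtains C where "C > 0"
    "\<And>x v. 1 \<le> x \<Longrightarrow> norm (matrix_powr x B *v v) \<le> C * x powr (c + \<eta>) * norm v"
    "\<And>x v. 0 < x \<Longrightarrow> x \<le> 1 \<Longrightarrow> norm (matrix_powr x B *v v) \<le> C * x powr (b - \<eta>) * norm v"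
proof -
  obtain C where C: "C > 0"
    "\<And>w u. (\<And>u i. ((\<lambda>u. w u $ i) has_real_derivative (B *v w u) $ i) (at u)) \<Longrightarrow> 0 \<le> u
        \<Longrightarrow> norm (w u) \<le> C * exp ((c + \<eta>) * u) * norm (w 0)"
    "\<And>w u. (\<And>u i. ((\<lambda>u. w u $ i) has_real_derivative (B *v w u) $ i) (at u)) \<Longrightarrow> u \<le> 0
        \<Longrightarrow> norm (w u) \<le> C * exp ((b - \<eta>) * u) * norm (w 0)"
    using triangular_flow_bounds[OF assms] by metis
  show ?thesis
  proof (rule that[OF C(1)])
    show "norm (matrix_powr x B *v v) \<le> C * x powr (c + \<eta>) * norm v" if "1 \<le> x" for x v
      using C(2)[OF matrix_exp_flow, of "ln x" v] that
      by (simp add: matrix_powr_def powr_def matrix_exp_0)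
    show "norm (matrix_powr x B *v v) \<le> C * x powr (b - \<eta>) * norm v" if "0 < x" "x \<le> 1" for x v
      using C(3)[OF matrix_exp_flow, of "ln x" v] that
      by (simp add: matrix_powr_def powr_def matrix_exp_0)
  qed
qed

subsection \<open>Uniform convergence and geometric iteration\<close>

text \<open>The classical Steinhaus-type argument: at a point \<open>(u, t)\<close> where \<open>R\<close> is large, the set of good
  \<open>y \<in> [1, 4]\<close> and the dilate by \<open>u\<close> of the set of good \<open>z \<in> [1, 2]\<close> are together too large to be
  disjoint.\<close>

lemma uniform_limit_from_pointwise:
  fixes R :: "real \<Rightarrow> real \<Rightarrow> real"
  assumes T: "T \<ge> 0" and C: "C > 0" and e: "e > 0"
    and meas: "\<And>t. t \<ge> T \<Longrightarrow> (\<lambda>x. R x t) \<in> borel_measurable (lebesgue_on {1..4})"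
    and lim: "\<And>x. x \<in> {1..4} \<Longrightarrow> (R x \<longlongrightarrow> 0) at_top"
    and sub: "\<And>t u z. t \<ge> T \<Longrightarrow> u \<in> {1..2} \<Longrightarrow> z \<in> {1..2}
                \<Longrightarrow> R u t \<le> C * (R (u * z) t + R z (u * t))"
  shows "\<forall>\<^sub>F t in at_top. \<forall>u\<in>{1..2}. R u t \<le> e"
proof (rule ccontr)
  assume contr: "\<not> ?thesis"
  have "\<exists>t u. t \<ge> max T (real n) \<and> u \<in> {1..2} \<and> R u t > e" for n
    using contr unfolding eventually_at_top_linorder by (meson not_le)
  then obtain t u where tn: "\<And>n. t n \<ge> max T (real n)" and u: "\<And>n. u n \<in> {1..2}"
    and big: "\<And>n. R (u n) (t n) > e"
    by metis
  \<comment> \<open>Two good values, each at most \<delta>, give at most \<open>e\<close> in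
    \<open>sub\<close>, which contradicts \<open>big\<close>.\<close>
  define \<delta> where "\<delta> = e / (2 * C)"
  have \<delta>: "\<delta> > 0" using e C by (simp add: \<delta>_def)
  \<comment> \<open>Points of \<open>{1..b}\<close> that are good from index \<open>n\<close>
    onwards. By pointwise convergence these sets increase to the whole interval, so their measures
    tend to \<open>b - 1\<close>.\<close>
  define V where "V \<tau> b n = {x \<in> {1..b}. \<forall>k\<ge>n. R x (\<tau> k) \<le> \<delta>}"
    for \<tau> :: "nat \<Rightarrow> real" and b :: real and n
  have V_sets: "V \<tau> b n \<in> sets lebesgue" if \<tau>: "\<And>k. \<tau> k \<ge> T" and b: "b \<in> {1..4}" for \<tau> b n
  proof -
    have "{x \<in> {1..b}. R x (\<tau> k) \<le> \<delta>} \<in> sets lebesgue" for k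
    proof -
      have "{x \<in> space (lebesgue_on {1..4}). R x (\<tau> k) \<le> \<delta>} \<in> sets (lebesgue_on {1..4})"
        using meas[OF \<tau>] by (rule borel_measurable_le) simp
      then have "{x \<in> {1..4}. R x (\<tau> k) \<le> \<delta>} \<in> sets lebesgue"
        by (auto simp: sets_restrict_space_iff)
      then have "{1..b} \<inter> {x \<in> {1..4}. R x (\<tau> k) \<le> \<delta>} \<in> sets lebesgue"
        by (intro sets.Int) auto
      also have "{1..b} \<inter> {x \<in> {1..4}. R x (\<tau> k) \<le> \<delta>} = {x \<in> {1..b}. R x (\<tau> k) \<le> \<delta>}"
        using b by auto
      finally show ?thesis .
    qed
    then have "(\<Inter>k\<in>{n..}. {x \<in> {1..b}. R x (\<tau> k) \<le> \<delta>}) \<in> sets lebesgue"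
      by (intro sets.countable_INT) auto
    also have "(\<Inter>k\<in>{n..}. {x \<in> {1..b}. R x (\<tau> k) \<le> \<delta>}) = V \<tau> b n"
      by (auto simp: V_def)
    finally show ?thesis .
  qed
  have V_lim: "(\<lambda>n. measure lebesgue (V \<tau> b n)) \<longlonglongrightarrow> b - 1"
    if \<tau>: "\<And>k. \<tau> k \<ge> max T (real k)" and b: "b \<in> {1..4}" for \<tau> b
  proof -
    have \<tau>_top: "filterlim \<tau> at_top sequentially"
      using \<tau> by (intro filterlim_at_top_mono[OF filterlim_real_sequentially]) auto
    have "x \<in> (\<Union>n. V \<tau> b n)" if x: "x \<in> {1..b}" for x
    proof -
      have "((\<lambda>k. R x (\<tau> k)) \<longlongrightarrow> 0) sequentially"
        using x b by (intro filterlim_compose[OF lim \<tau>_top]) auto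
      then have "\<forall>\<^sub>F k in sequentially. R x (\<tau> k) < \<delta>"
        using \<delta> by (rule order_tendstoD)
      then show ?thesis
        using x by (force simp: V_def eventually_sequentially intro: less_imp_le)
    qed
    then have U: "(\<Union>n. V \<tau> b n) = {1..b}"
      by (auto simp: V_def)
    have "incseq (V \<tau> b)"
      by (auto simp: incseq_def V_def)
    then have "(\<lambda>n. measure lebesgue (V \<tau> b n)) \<longlonglongrightarrow> measure lebesgue (\<Union>n. V \<tau> b n)"
      using \<tau> b by (intro Lim_measure_incseq) (auto intro!: V_sets simp: U)
    then show ?thesis using b by (simp add: U)
  qed
  define s where "s n = u n * t n" for n
  have t_T: "t n \<ge> T" for n using tn[of n] by auto
  have s_ge: "s n \<ge> max T (real n)" for n
  proof -
    have "1 * t n \<le> u n * t n" using u[of n] tn[of n] T by (intro mult_right_mono) auto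
    then show ?thesis using tn[of n] by (simp add: s_def)
  qed
  then have s_T: "s n \<ge> T" for n by (meson max.boundedE)
  \<comment> \<open>The limits are \<open>3\<close> and \<open>1\<close>; the thresholds
    \<open>5 / 2\<close> and \<open>1 / 2\<close> add up to \<open>3\<close>, the length of
    \<open>{1..4}\<close>.\<close>
  have "\<forall>\<^sub>F n in sequentially. measure lebesgue (V t 4 n) > 5 / 2"
    using V_lim[of t 4, OF tn] by (intro order_tendstoD) auto
  moreover have "\<forall>\<^sub>F n in sequentially. measure lebesgue (V s 2 n) > 1 / 2"
    using V_lim[of s 2, OF s_ge] by (intro order_tendstoD) auto
  ultimately obtain n where n: "measure lebesgue (V t 4 n) > 5 / 2" "measure lebesgue (V s 2 n) > 1 / 2"
    by (metis (mono_tags, lifting) eventually_conj eventually_sequentially order_refl)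
  \<comment> \<open>Dilation by \<open>u n \<ge> 1\<close> does not decrease measure, and
    \<open>u n \<le> 2\<close> keeps the image of a subset of \<open>{1..2}\<close> inside
    \<open>{1..4}\<close>.\<close>
  define W where "W = (\<lambda>z. u n * z) ` V s 2 n"
  have un: "u n \<ge> 1" "u n \<le> 2" using u[of n] by auto
  have V4: "V t 4 n \<in> sets lebesgue" "V t 4 n \<subseteq> {1..4}"
        by (rule V_sets[OF t_T]) (auto simp: V_def)
  have W_sets: "W \<in> sets lebesgue"
  proof -
    have "(\<lambda>x. (1 / u n) *\<^sub>R x) -` V s 2 n \<inter> space lebesgue \<in> sets lebesgue"
      using V_sets[of s 2 n, OF s_T] by (intro measurable_sets[OF lebesgue_measurable_scaling]) auto
    also have "(\<lambda>x. (1 / u n) *\<^sub>R x) -` V s 2 n \<inter> space lebesgue = W"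
      using un by (force simp: W_def image_iff)
    finally show ?thesis .
  qed
  have W_sub: "W \<subseteq> {1..4}"
  proof
    fix y assume "y \<in> W"
    then obtain z where z: "1 \<le> z" "z \<le> 2" "y = u n * z" by (auto simp: W_def V_def)
    then show "y \<in> {1..4}"
      using un mult_mono[of 1 "u n" 1 z] mult_mono[of "u n" 2 z 2] by auto
  qed
  have "measure lebesgue W = u n * measure lebesgue (V s 2 n)"
    using measure_lebesgue_affine[of "u n" 0 "V s 2 n"] un by (simp add: W_def)
  moreover have "1 * measure lebesgue (V s 2 n) \<le> u n * measure lebesgue (V s 2 n)"
    using un by (intro mult_right_mono) auto
  ultimately have W: "measure lebesgue W > 1 / 2"
    using n(2) by linarith
  have fm: "A \<in> lmeasurable" if "A \<in> sets lebesgue" "A \<subseteq> {1..4::real}" for A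
    by (rule fmeasurableI2[OF _ that(2,1)]) auto
  have fin: "emeasure lebesgue A \<noteq> \<infinity>" if "A \<in> sets lebesgue" "A \<subseteq> {1..4::real}" for A
    unfolding infinity_ennreal_def by (rule fmeasurableD2[OF fm[OF that]])
  have "V t 4 n \<inter> W \<noteq> {}"
  proof
    assume disj: "V t 4 n \<inter> W = {}"
    have "measure lebesgue (V t 4 n \<union> W) = measure lebesgue (V t 4 n) + measure lebesgue W"
      using disj V4 W_sets W_sub by (intro measure_Union fin) auto
    moreover have "measure lebesgue (V t 4 n \<union> W) \<le> measure lebesgue {1..4::real}"
      using V4 W_sets W_sub by (intro measure_mono_fmeasurable) auto
    ultimately show False using n(1) W by simp
  qed
  then obtain z where z: "z \<in> V s 2 n" "u n * z \<in> V t 4 n" by (auto simp: W_def)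
  have "R (u n) (t n) \<le> C * (R (u n * z) (t n) + R z (u n * t n))"
    using z u by (intro sub t_T) (auto simp: V_def)
  also have "\<dots> \<le> C * (\<delta> + \<delta>)"
    using z C by (intro mult_left_mono add_mono) (auto simp: V_def s_def)
  also have "\<dots> = e" using C by (simp add: \<delta>_def)
  finally show False using big[of n] by simp
qed

text \<open>Common induction for \<open>q = 2\<close> and \<open>q = 1 / 2\<close>: one factor
  \<open>q\<close> is split off by \<open>cocycle\<close> and the induction hypothesis is used at
  \<open>q * t\<close>, which \<open>between\<close> keeps in range. Assumption \<open>small\<close>
  balances the inherited error, damped by \<theta>, against the new error \<delta> amplified by
  \<open>P\<close>.\<close>

lemma geometric_iteration:
  fixes r :: "real \<Rightarrow> real \<Rightarrow> 'a::real_normed_vector" and \<phi> :: "real \<Rightarrow> real"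
  assumes q: "q > 0" and S: "\<And>y. y \<in> S \<Longrightarrow> y > 0"
    and nonneg: "\<kappa> \<ge> 0" "C \<ge> 0" "\<And>t. t \<ge> T \<Longrightarrow> \<phi> t \<ge> 0"
    and cocycle: "\<And>x t. x > 0 \<Longrightarrow> r (x * q) t = r x (q * t) + P x (r q t)"
    and P: "\<And>y k v. y \<in> S \<Longrightarrow> norm (P (y * q ^ k) v) \<le> C * (y * q ^ k) powr p * norm v"
    and between: "\<And>y k t. y \<in> S \<Longrightarrow> t \<ge> T \<Longrightarrow> y * q ^ Suc k * t \<ge> T \<Longrightarrow> q * t \<ge> T"
    and base: "\<And>y t. y \<in> S \<Longrightarrow> t \<ge> T \<Longrightarrow> y * t \<ge> T \<Longrightarrow> norm (r y t) \<le> \<kappa> * y powr p * \<phi> t"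
    and step: "\<And>t. t \<ge> T \<Longrightarrow> q * t \<ge> T \<Longrightarrow> norm (r q t) \<le> \<delta> * \<phi> t"
    and growth: "\<And>t. t \<ge> T \<Longrightarrow> q * t \<ge> T \<Longrightarrow> \<phi> (q * t) \<le> \<theta> * q powr p * \<phi> t"
    and small: "\<kappa> * \<theta> * q powr p + C * \<delta> \<le> \<kappa> * q powr p"
    and y: "y \<in> S"
  shows "t \<ge> T \<Longrightarrow> y * q ^ k * t \<ge> T \<Longrightarrow> norm (r (y * q ^ k) t) \<le> \<kappa> * (y * q ^ k) powr p * \<phi> t"
proof (induction k arbitrary: t)
  case 0
  then show ?case using base y by simp
next
  case (Suc k)
  define x where "x = y * q ^ k"
  have x: "x > 0" using S[OF y] q by (simp add: x_def)
  have xq: "y * q ^ Suc k = x * q" by (simp add: x_def)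
  have qt: "q * t \<ge> T" using between[OF y Suc.prems] .
  have "norm (r (x * q) t) \<le> norm (r x (q * t)) + norm (P x (r q t))"
    unfolding cocycle[OF x] by (rule norm_triangle_ineq)
  also have "norm (r x (q * t)) \<le> \<kappa> * x powr p * \<phi> (q * t)"
    using Suc.IH[OF qt] Suc.prems(2) by (simp add: x_def mult_ac)
  also have "\<dots> \<le> \<kappa> * x powr p * (\<theta> * q powr p * \<phi> t)"
    using nonneg growth[OF Suc.prems(1) qt] by (intro mult_left_mono) auto
  also have "norm (P x (r q t)) \<le> C * x powr p * norm (r q t)"
    unfolding x_def by (rule P[OF y])
  also have "\<dots> \<le> C * x powr p * (\<delta> * \<phi> t)"
    using nonneg step[OF Suc.prems(1) qt] by (intro mult_left_mono) auto
  also have "\<kappa> * x powr p * (\<theta> * q powr p * \<phi> t) + C * x powr p * (\<delta> * \<phi> t)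
      = (\<kappa> * \<theta> * q powr p + C * \<delta>) * (x powr p * \<phi> t)"
    by (simp add: algebra_simps)
  also have "\<dots> \<le> \<kappa> * q powr p * (x powr p * \<phi> t)"
    using nonneg Suc.prems by (intro mult_right_mono small) auto
  also have "\<dots> = \<kappa> * (x * q) powr p * \<phi> t"
    using x q by (simp add: powr_mult)
  finally show ?case unfolding xq by simp
qed

lemma dyadic_decomposition:
  assumes "1 \<le> (x::real)"
  obtains y k where "y \<in> {1..2}" "x = y * 2 ^ k"
proof -
  define k where "k = nat \<lfloor>log 2 x\<rfloor>"
  have "real k \<le> log 2 x" "log 2 x < real k + 1"
    using assms by (auto simp: k_def)
  then have "2 ^ k \<le> x" "x < 2 * 2 ^ k"
    using assms by (simp_all add: le_log_iff log_less_iff powr_realpow powr_add mult.commute)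
  then show ?thesis
    by (intro that[of "x / 2 ^ k" k]) (auto simp: field_simps)
qed

subsection \<open>Regularly varying vectors\<close>

lemma powr_between_half_and_two:
  fixes x p :: real
  assumes "1 / 2 \<le> x" "x \<le> 2"
  shows "x powr p \<le> 2 powr \<bar>p\<bar>" and "2 powr (- \<bar>p\<bar>) \<le> x powr p"
proof -
  have "ln (1 / 2) \<le> ln x" "ln x \<le> ln 2"
    using assms by (subst ln_le_cancel_iff; simp)+
  then have "\<bar>ln x\<bar> \<le> ln 2"
    by (simp add: ln_div abs_le_iff)
  then have "\<bar>p * ln x\<bar> \<le> \<bar>p\<bar> * ln 2"
    unfolding abs_mult by (intro mult_left_mono) auto
  then show "x powr p \<le> 2 powr \<bar>p\<bar>" and "2 powr (- \<bar>p\<bar>) \<le> x powr p"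
    using assms by (auto simp: powr_def)
qed

locale regularly_varying_vector =
  fixes B :: "real ^ 'n::{finite,linorder} ^ 'n::{finite,linorder}"
    and D :: "real set" and g :: "real \<Rightarrow> real ^ 'n::{finite,linorder}"
  assumes tri: "upper_triangular_matrix B"
    and diag: "\<And>i j. i \<le> j \<Longrightarrow> B $ j $ j \<le> B $ i $ i"
    and rv: "regularly_varying B D g"
begin

definition \<phi> :: "real \<Rightarrow> real" where
  "\<phi> t = \<bar>g t $ last_ix\<bar>"

definition err :: "real \<Rightarrow> real \<Rightarrow> real ^ 'n::_" where
  "err x t = g (x * t) - matrix_powr x B *v g t"

abbreviation "b_min \<equiv> B $ last_ix $ last_ix"

abbreviation "b_max \<equiv> B $ first_ix $ first_ix"

text \<open>Insert \<open>matrix_powr x B *v g (y * t)\<close> and use multiplicativity of powers.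
  The case \<open>y = 2\<close> or \<open>y = 1 / 2\<close> drives the iteration; the case
  \<open>y = 1 / x\<close> converts bounds for arguments above \<open>1\<close> into bounds below
  \<open>1\<close>.\<close>

lemma err_mult:
  assumes "x > 0" "y > 0"
  shows "err (x * y) t = err x (y * t) + matrix_powr x B *v err y t"
  using triangular_powr_mult[OF tri assms]
  by (simp add: err_def matrix_vector_mult_diff_distrib mult.assoc)

lemma diag_bounds: "b_min \<le> B $ i $ i" "B $ i $ i \<le> b_max"
  by (auto intro: diag)

text \<open>For \<open>z\<close> in \<open>{1..2}\<close> the inverse of
  \<open>matrix_powr z B\<close> is the power with base \<open>1 / z\<close>, which lies in this
  range; the bound controls the cost of undoing such a power.\<close>

lemma powr_bounded:
  obtains C where "C \<ge> 1"
    "\<And>x v. 1 / 2 \<le> x \<Longrightarrow> x \<le> 1 \<Longrightarrow> norm (matrix_powr x B *v v) \<le> C * norm v"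
proof -
  obtain C where C: "C > 0" "\<And>x v. 0 < x \<Longrightarrow> x \<le> 1
      \<Longrightarrow> norm (matrix_powr x B *v v) \<le> C * x powr (b_min - 1) * norm v"
    by (rule triangular_powr_bounds[OF tri zero_less_one diag_bounds]) (rule that)
  show ?thesis
  proof (rule that[of "max 1 (C * 2 powr \<bar>b_min - 1\<bar>)"])
    fix x :: real and v :: "real ^ 'n::_" assume x: "1 / 2 \<le> x" "x \<le> 1"
    have "x powr (b_min - 1) \<le> 2 powr \<bar>b_min - 1\<bar>"
      using x by (intro powr_between_half_and_two) auto
    then have "C * x powr (b_min - 1) * norm v \<le> max 1 (C * 2 powr \<bar>b_min - 1\<bar>) * norm v"
      using C(1) by (intro mult_right_mono) (auto simp: le_max_iff_disj)
    then show "norm (matrix_powr x B *v v) \<le> max 1 (C * 2 powr \<bar>b_min - 1\<bar>) * norm v"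
      using C(2)[of x v] x by simp
  qed simp
qed

section \<open>Limits for fixed \<open>x\<close>, measurability, and uniformity on
  \<open>[1, 2]\<close>\<close>

lemma eventually_domain:
  obtains T where "T > 0" "{T..} \<subseteq> D" "\<And>t. t \<ge> T \<Longrightarrow> \<phi> t > 0"
proof -
  obtain t0 where t0: "{t0..} \<subseteq> D"
    using rv by (auto simp: regularly_varying_def rate_vector_def nbhd_of_infinity_def)
  have "eventually_constant_sign (\<lambda>t. g t $ last_ix)"
    using rv by (auto simp: regularly_varying_def rate_vector_def)
  then have "\<forall>\<^sub>F t in at_top. \<phi> t > 0"
    unfolding eventually_constant_sign_def by (auto simp: \<phi>_def elim!: eventually_mono)
  then obtain t1 where t1: "\<And>t. t \<ge> t1 \<Longrightarrow> \<phi> t > 0"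
    by (auto simp: eventually_at_top_linorder)
  show ?thesis
    by (rule that[of "max 1 (max t0 t1)"]) (use t0 t1 in auto)
qed

lemma err_component_tendsto:
  assumes "x > 0"
  shows "((\<lambda>t. err x t $ i / \<phi> t) \<longlongrightarrow> 0) at_top"
  using rv assms unfolding regularly_varying_def err_def \<phi>_def
  by (intro smalloD_tendsto) auto

lemma err_tendsto:
  assumes "x > 0"
  shows "((\<lambda>t. norm (err x t) / \<phi> t) \<longlongrightarrow> 0) at_top"
proof -
  have "((\<lambda>t. \<chi> i. err x t $ i / \<phi> t) \<longlongrightarrow> (\<chi> i. 0)) at_top"
    by (intro tendsto_vec_lambda err_component_tendsto assms)
  then have "((\<lambda>t. (1 / \<phi> t) *\<^sub>R err x t) \<longlongrightarrow> 0) at_top"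
    by (simp add: scaleR_vec_def zero_vec_def)
  from tendsto_norm[OF this] show ?thesis
    by (simp add: \<phi>_def)
qed

text \<open>The last coordinate of \<open>matrix_powr x B *v g t\<close> is a scalar power times
  that of \<open>g t\<close>, so the reverse triangle inequality bounds the deviation by the last
  coordinate of \<open>err x t\<close>.\<close>

lemma \<phi>_ratio_tendsto:
  assumes x: "x > 0"
  shows "((\<lambda>t. \<phi> (x * t) / \<phi> t) \<longlongrightarrow> x powr b_min) at_top"
proof -
  obtain T where T: "\<And>t. t \<ge> T \<Longrightarrow> \<phi> t > 0"
    using eventually_domain by metis
  have "((\<lambda>t. \<phi> (x * t) / \<phi> t - x powr b_min) \<longlongrightarrow> 0) at_top"
  proof (rule Lim_null_comparison)
    show "((\<lambda>t. \<bar>err x t $ last_ix / \<phi> t\<bar>) \<longlongrightarrow> 0) at_top"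
      using err_component_tendsto[OF x] by (rule tendsto_rabs_zero)
    show "\<forall>\<^sub>F t in at_top. norm (\<phi> (x * t) / \<phi> t - x powr b_min) \<le> \<bar>err x t $ last_ix / \<phi> t\<bar>"
      using eventually_ge_at_top[of T]
    proof eventually_elim
      case (elim t)
      have "\<bar>\<phi> (x * t) - x powr b_min * \<phi> t\<bar> \<le> \<bar>err x t $ last_ix\<bar>"
        using abs_triangle_ineq3[of "g (x * t) $ last_ix" "x powr b_min * g t $ last_ix"]
        by (simp add: \<phi>_def err_def triangular_powr_last[OF tri x] abs_mult)
      then show ?case
        using T[OF elim] by (simp add: field_simps abs_divide)
    qed
  qed
  then show ?thesis by (simp add: LIM_zero_iff)
qed

text \<open>As \<open>g\<close> is known to be measurable on \<open>D\<close> only, it is extended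
  by zero before scaling; for \<open>x \<ge> 1\<close> the argument \<open>x * t\<close> stays in
  \<open>{T..}\<close>, where the extension agrees with \<open>g\<close>.\<close>

lemma scaled_measurable:
  assumes "{T..} \<subseteq> D" "t \<ge> T" "T > 0"
  shows "(\<lambda>x. g (x * t)) \<in> borel_measurable (lebesgue_on {1..4})"
proof -
  have "(\<lambda>s. if s \<in> D then g s else 0) \<in> borel_measurable lebesgue"
    using rv by (subst borel_measurable_if) (auto simp: regularly_varying_def)
  from measurable_compose[OF lebesgue_measurable_scaling this, of t]
  have "(\<lambda>x. if t * x \<in> D then g (t * x) else 0) \<in> borel_measurable (lebesgue_on {1..4})"
    unfolding real_scaleR_def by (rule measurable_restrict_space1)
  moreover have "t * x \<in> D" if "x \<in> {1..4}" for x
  proof -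
    have "t * 1 \<le> t * x" using assms that by (intro mult_left_mono) auto
    then have "t * x \<in> {T..}" using assms(2) by simp
    then show ?thesis using assms(1) by blast
  qed
  ultimately show ?thesis
    by (subst measurable_cong[where g = "\<lambda>x. if t * x \<in> D then g (t * x) else 0"])
       (auto simp: mult.commute)
qed

text \<open>After taking logarithms the deviation \<open>h\<close> is additive,
  \<open>h (u * z) t = h u t + h z (u * t)\<close>, so \<open>sub\<close> is the triangle inequality
  with constant \<open>1\<close>.\<close>

lemma \<phi>_uniform:
  assumes e: "e > 0"
  shows "\<forall>\<^sub>F t in at_top. \<forall>u\<in>{1..2}. \<bar>ln (\<phi> (u * t) / \<phi> t) - b_min * ln u\<bar> \<le> e"
proof -
  obtain T where T: "T > 0" "{T..} \<subseteq> D" "\<And>t. t \<ge> T \<Longrightarrow> \<phi> t > 0"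
    using eventually_domain by metis
  show ?thesis
  proof (rule uniform_limit_from_pointwise[of T 1])
    fix t assume t: "t \<ge> T"
    note [measurable] = scaled_measurable[OF T(2) t T(1)]
    have [measurable]: "(\<lambda>x. x) \<in> borel_measurable (lebesgue_on {1..4::real})"
      by (intro measurable_restrict_space1 measurable_completion) simp
    have comp: "(\<lambda>x. g (x * t) $ last_ix) \<in> borel_measurable (lebesgue_on {1..4})"
      by (rule borel_measurable_continuous_on[OF _ scaled_measurable[OF T(2) t T(1)]])
         (intro continuous_intros)
    note [measurable] = comp
    show "(\<lambda>x. \<bar>ln (\<phi> (x * t) / \<phi> t) - b_min * ln x\<bar>) \<in> borel_measurable (lebesgue_on {1..4})"
      unfolding \<phi>_def by measurable
  next
    fix x :: real assume x: "x \<in> {1..4}"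
    have "((\<lambda>t. ln (\<phi> (x * t) / \<phi> t) - b_min * ln x) \<longlongrightarrow> ln (x powr b_min) - b_min * ln x) at_top"
      using x by (intro tendsto_intros \<phi>_ratio_tendsto) auto
    then show "((\<lambda>t. \<bar>ln (\<phi> (x * t) / \<phi> t) - b_min * ln x\<bar>) \<longlongrightarrow> 0) at_top"
      using x by (intro tendsto_rabs_zero) (simp add: ln_powr)
  next
    fix t u z :: real assume t: "t \<ge> T" and u: "u \<in> {1..2}" and z: "z \<in> {1..2}"
    have "1 * t \<le> u * t" "1 * (u * t) \<le> z * (u * t)"
      using t u z T(1) by (intro mult_right_mono; simp)+
    then have "\<phi> t > 0" "\<phi> (u * t) > 0" "\<phi> (u * z * t) > 0"
      using t T(3) by (auto simp: mult_ac)
    then show "\<bar>ln (\<phi> (u * t) / \<phi> t) - b_min * ln u\<bar>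
        \<le> 1 * (\<bar>ln (\<phi> (u * z * t) / \<phi> t) - b_min * ln (u * z)\<bar>
                + \<bar>ln (\<phi> (z * (u * t)) / \<phi> (u * t)) - b_min * ln z\<bar>)"
      using u z by (simp add: ln_div ln_mult algebra_simps mult_ac)
  qed (use T e in auto)
qed

lemma \<phi>_bounds:
  assumes "\<phi> t > 0" "\<phi> (u * t) > 0" "u > 0" "\<bar>ln (\<phi> (u * t) / \<phi> t) - b_min * ln u\<bar> \<le> e"
  shows "\<phi> (u * t) \<le> exp e * u powr b_min * \<phi> t" "\<phi> t \<le> exp e * u powr (- b_min) * \<phi> (u * t)"
proof -
  have "ln (\<phi> (u * t)) \<le> e + b_min * ln u + ln (\<phi> t)"
    "ln (\<phi> t) \<le> e + - b_min * ln u + ln (\<phi> (u * t))"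
    using assms by (auto simp: ln_div abs_le_iff)
  then have "exp (ln (\<phi> (u * t))) \<le> exp (e + b_min * ln u + ln (\<phi> t))"
    "exp (ln (\<phi> t)) \<le> exp (e + - b_min * ln u + ln (\<phi> (u * t)))"
    by simp_all
  then show "\<phi> (u * t) \<le> exp e * u powr b_min * \<phi> t" "\<phi> t \<le> exp e * u powr (- b_min) * \<phi> (u * t)"
    unfolding exp_add using assms by (simp_all add: powr_def)
qed

text \<open>Here \<open>sub\<close> comes from solving \<open>err_mult\<close> for
  \<open>err u t\<close> by applying \<open>matrix_powr (1 / z) B\<close>, at cost \<open>C\<close>.
  The factor \<open>L\<close> changes the normalisation from \<open>\<phi> (u * t)\<close> to
  \<open>\<phi> t\<close>, which is why uniformity for \<phi> is established first.\<close>

lemma err_uniform: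
  assumes e: "e > 0"
  shows "\<forall>\<^sub>F t in at_top. \<forall>u\<in>{1..2}. norm (err u t) / \<phi> t \<le> e"
proof -
  obtain T0 where T0: "T0 > 0" "{T0..} \<subseteq> D" "\<And>t. t \<ge> T0 \<Longrightarrow> \<phi> t > 0"
    using eventually_domain by metis
  obtain T1 where T1: "\<And>t u. t \<ge> T1 \<Longrightarrow> u \<in> {1..2} \<Longrightarrow> \<bar>ln (\<phi> (u * t) / \<phi> t) - b_min * ln u\<bar> \<le> 1"
    using \<phi>_uniform[OF zero_less_one] unfolding eventually_at_top_linorder by blast
  define T where "T = max T0 T1"
  have T: "T > 0" "{T..} \<subseteq> D" "\<And>t. t \<ge> T \<Longrightarrow> \<phi> t > 0"
    using T0 by (auto simp: T_def)
  \<comment> \<open>Bounds \<open>\<phi> (u * t) / \<phi> t\<close> for \<open>u\<close> in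
    \<open>{1..2}\<close>; the factor \<open>exp 1\<close> reflects the tolerance \<open>1\<close>
    chosen for \<open>T1\<close>.\<close>
  define L where "L = exp 1 * 2 powr \<bar>b_min\<bar>"
  have "2 powr \<bar>b_min\<bar> \<ge> (1::real)" by (rule ge_one_powr_ge_zero) auto
  then have L: "L \<ge> 1"
    unfolding L_def using mult_mono[of 1 "exp 1 :: real" 1] by simp
  obtain C where C: "C \<ge> 1"
    "\<And>x v. 1 / 2 \<le> x \<Longrightarrow> x \<le> 1 \<Longrightarrow> norm (matrix_powr x B *v v) \<le> C * norm v"
    using powr_bounded by metis
  show ?thesis
  proof (rule uniform_limit_from_pointwise[of T "C * L"])
    fix t assume t: "t \<ge> T"
    have "continuous_on {1..4} (\<lambda>x. matrix_powr x B *v g t)"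
      by (rule continuous_on_subset[OF continuous_on_matrix_powr]) auto
    then have [measurable]: "(\<lambda>x. matrix_powr x B *v g t) \<in> borel_measurable (lebesgue_on {1..4})"
      by (intro continuous_imp_measurable_on_sets_lebesgue) auto
    note [measurable] = scaled_measurable[OF T(2) t T(1)]
    show "(\<lambda>x. norm (err x t) / \<phi> t) \<in> borel_measurable (lebesgue_on {1..4})"
      unfolding err_def by measurable
  next
    fix x :: real assume "x \<in> {1..4}"
    then show "((\<lambda>t. norm (err x t) / \<phi> t) \<longlongrightarrow> 0) at_top"
      by (intro err_tendsto) auto
  next
    fix t u z :: real assume t: "t \<ge> T" and u: "u \<in> {1..2}" and z: "z \<in> {1..2}"
    have "1 * t \<le> u * t"
      using t u T(1) by (intro mult_right_mono) auto
    then have pos: "\<phi> t > 0" "\<phi> (u * t) > 0"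
      using t T(3) by auto
    have "\<phi> (u * t) \<le> exp 1 * u powr b_min * \<phi> t"
      using pos u t by (intro \<phi>_bounds T1) (auto simp: T_def)
    also have "u powr b_min \<le> 2 powr \<bar>b_min\<bar>"
      using u by (intro powr_between_half_and_two) auto
    finally have ratio: "\<phi> (u * t) \<le> L * \<phi> t"
      using pos by (simp add: L_def)
    have "err u t = matrix_powr (1 / z) B *v (matrix_powr z B *v err u t)"
      using triangular_powr_mult[OF tri, of "1 / z" z "err u t"] z by simp
    also have "\<dots> = matrix_powr (1 / z) B *v (err (u * z) t - err z (u * t))"
      using err_mult[of z u t] u z by (simp add: mult.commute)
    finally have "norm (err u t) \<le> C * norm (err (u * z) t - err z (u * t))"
      using C(2)[of "1 / z"] z by (simp add: divide_simps)
    also have "\<dots> \<le> C * (norm (err (u * z) t) + norm (err z (u * t)))"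
      using C(1) by (intro mult_left_mono norm_triangle_ineq4) auto
    finally have "norm (err u t) / \<phi> t \<le> C * (norm (err (u * z) t) / \<phi> t + norm (err z (u * t)) / \<phi> t)"
      using pos by (simp add: divide_simps)
    also have "\<dots> \<le> C * (L * (norm (err (u * z) t) / \<phi> t) + L * (norm (err z (u * t)) / \<phi> (u * t)))"
    proof (intro mult_left_mono add_mono)
      show "norm (err (u * z) t) / \<phi> t \<le> L * (norm (err (u * z) t) / \<phi> t)"
        using L pos mult_right_mono[of 1 L "norm (err (u * z) t) / \<phi> t"] by simp
      have "norm (err z (u * t)) / (L * \<phi> t) \<le> norm (err z (u * t)) / \<phi> (u * t)"
        using ratio pos by (intro divide_left_mono) (auto intro: order_less_le_trans)
      then show "norm (err z (u * t)) / \<phi> t \<le> L * (norm (err z (u * t)) / \<phi> (u * t))"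
        using L pos by (simp add: field_simps)
    qed (use C in auto)
    finally show "norm (err u t) / \<phi> t
        \<le> C * L * (norm (err (u * z) t) / \<phi> t + norm (err z (u * t)) / \<phi> (u * t))"
      by (simp add: algebra_simps)
  qed (use T e C L in auto)
qed

text \<open>Potter-type bounds: the estimates on one dyadic block, uniform in \<open>t\<close>, are
  propagated to all admissible \<open>x\<close> by \<open>geometric_iteration\<close>, upwards with
  \<open>q = 2\<close> and downwards with \<open>q = 1 / 2\<close>.\<close>

lemma potter:
  assumes \<kappa>: "\<kappa> > 0" and \<epsilon>: "\<epsilon> > 0"
  obtains T where "T > 0" "{T..} \<subseteq> D" "\<And>t. t \<ge> T \<Longrightarrow> \<phi> t > 0"
    "\<And>t x. t \<ge> T \<Longrightarrow> 1 \<le> x \<Longrightarrow> norm (err x t) \<le> \<kappa> * x powr (b_max + \<epsilon>) * \<phi> t"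
    "\<And>t x. t \<ge> T \<Longrightarrow> 0 < x \<Longrightarrow> x \<le> 1 \<Longrightarrow> x * t \<ge> T
        \<Longrightarrow> norm (err x t) \<le> \<kappa> * x powr (b_min - \<epsilon>) * \<phi> t"
proof -
  obtain C where C: "C > 0"
    "\<And>x v. 1 \<le> x \<Longrightarrow> norm (matrix_powr x B *v v) \<le> C * x powr (b_max + \<epsilon>) * norm v"
    "\<And>x v. 0 < x \<Longrightarrow> x \<le> 1 \<Longrightarrow> norm (matrix_powr x B *v v) \<le> C * x powr (b_min - \<epsilon>) * norm v"
    by (rule triangular_powr_bounds[OF tri \<epsilon> diag_bounds]) (rule that)
  obtain C1 where C1: "C1 \<ge> 1"
    "\<And>x v. 1 / 2 \<le> x \<Longrightarrow> x \<le> 1 \<Longrightarrow> norm (matrix_powr x B *v v) \<le> C1 * norm v"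
    using powr_bounded by metis
  \<comment> \<open>Half of \<epsilon> is spent on the uniform error in the growth of \<phi>; the
    other half remains as the contraction factor \<theta>.\<close>
  define \<theta> :: real where "\<theta> = 2 powr (- \<epsilon> / 2)"
  have \<theta>: "0 < \<theta>" "\<theta> < 1"
    using \<epsilon> powr_less_mono[of "- \<epsilon> / 2" 0 "2 :: real"] by (simp_all add: \<theta>_def)
  \<comment> \<open>Admissible one-step error for exponent \<open>p\<close>: the factor
    \<open>2 powr (- \<bar>p\<bar>)\<close> puts it below \<open>\<kappa> * y powr p\<close> on
    \<open>[1/2, 2]\<close>, and the fraction ensures
    \<open>C * m p \<le> \<kappa> * q powr p * (1 - \<theta>)\<close>.\<close>
  define m where "m p = \<kappa> * 2 powr (- \<bar>p\<bar>) * ((1 - \<theta>) / (C + 1))" for p :: real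
  have frac: "0 < (1 - \<theta>) / (C + 1)" "(1 - \<theta>) / (C + 1) \<le> 1" "C * ((1 - \<theta>) / (C + 1)) \<le> 1 - \<theta>"
    using \<theta> C(1) by (auto simp: field_simps)
  have m_pos: "m p > 0" for p
    unfolding m_def using \<kappa> frac(1) by (intro mult_pos_pos) auto
  have m_base: "m p \<le> \<kappa> * y powr p" if "1 / 2 \<le> y" "y \<le> 2" for p y
  proof -
    have "m p \<le> \<kappa> * 2 powr (- \<bar>p\<bar>) * 1"
      unfolding m_def using \<kappa> frac(2) by (intro mult_left_mono) auto
    also have "\<dots> \<le> \<kappa> * y powr p"
      using \<kappa> powr_between_half_and_two(2)[OF that] by simp
    finally show ?thesis .
  qed
  have m_step: "\<kappa> * \<theta> * q powr p + C * \<delta> \<le> \<kappa> * q powr p"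
    if q: "1 / 2 \<le> q" "q \<le> 2" and \<delta>: "\<delta> \<le> m p" for q p \<delta>
  proof -
    have "C * \<delta> \<le> C * m p"
      using C(1) \<delta> by (intro mult_left_mono) auto
    also have "\<dots> = (\<kappa> * 2 powr (- \<bar>p\<bar>)) * (C * ((1 - \<theta>) / (C + 1)))"
      by (simp add: m_def)
    also have "\<dots> \<le> (\<kappa> * q powr p) * (1 - \<theta>)"
      using \<kappa> \<theta> C(1) frac powr_between_half_and_two(2)[OF q, of p]
      by (intro mult_mono) auto
    finally show ?thesis by (simp add: algebra_simps)
  qed
  define e where "e = \<epsilon> / 2 * ln 2"
  have e: "e > 0" "exp e = 2 powr (\<epsilon> / 2)" using \<epsilon> by (simp_all add: e_def powr_def)
  define L where "L = exp e * 2 powr \<bar>b_min\<bar>"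
  have "1 * 1 \<le> exp e * 2 powr \<bar>b_min\<bar>"
    using e(1) by (intro mult_mono ge_one_powr_ge_zero) auto
  then have L: "L \<ge> 1" by (simp add: L_def)
  \<comment> \<open>Downward errors are obtained by inverting upward ones, which costs the factor
    \<open>C1 * L\<close>; dividing by it lets one \<delta> serve both directions.\<close>
  define \<delta> where "\<delta> = min (m (b_max + \<epsilon>)) (m (b_min - \<epsilon>)) / (C1 * L)"
  have C1L: "1 \<le> C1 * L" using mult_mono[of 1 C1 1 L] C1 L by simp
  have \<delta>_pos: "\<delta> > 0"
    unfolding \<delta>_def using C1L m_pos by (intro divide_pos_pos) auto
  have \<delta>_m: "C1 * L * \<delta> \<le> m (b_max + \<epsilon>)" "C1 * L * \<delta> \<le> m (b_min - \<epsilon>)"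
    using C1L by (auto simp: \<delta>_def)
  have "1 * \<delta> \<le> C1 * L * \<delta>"
    using C1L \<delta>_pos by (intro mult_right_mono) auto
  then have \<delta>_max: "\<delta> \<le> m (b_max + \<epsilon>)" using \<delta>_m by linarith
  obtain T0 where T0: "T0 > 0" "{T0..} \<subseteq> D" "\<And>t. t \<ge> T0 \<Longrightarrow> \<phi> t > 0"
    using eventually_domain by metis
  obtain T1 where T1: "\<And>t u. t \<ge> T1 \<Longrightarrow> u \<in> {1..2} \<Longrightarrow> \<bar>ln (\<phi> (u * t) / \<phi> t) - b_min * ln u\<bar> \<le> e"
    using \<phi>_uniform[OF e(1)] unfolding eventually_at_top_linorder by blast
  obtain T2 where T2: "\<And>t u. t \<ge> T2 \<Longrightarrow> u \<in> {1..2} \<Longrightarrow> norm (err u t) / \<phi> t \<le> \<delta>"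
    using err_uniform[OF \<delta>_pos] unfolding eventually_at_top_linorder by blast
  define T where "T = max T0 (max T1 T2)"
  have T: "T > 0" "{T..} \<subseteq> D" and pos: "\<And>t. t \<ge> T \<Longrightarrow> \<phi> t > 0"
    using T0 by (auto simp: T_def)
  have err_small: "norm (err u t) \<le> \<delta> * \<phi> t" if "t \<ge> T" "u \<in> {1..2}" for t u
    using T2[of t u] that pos[of t] by (simp add: T_def field_simps)
  have \<phi>_up: "\<phi> (u * t) \<le> exp e * u powr b_min * \<phi> t"
    and \<phi>_down: "\<phi> t \<le> exp e * u powr (- b_min) * \<phi> (u * t)" if "t \<ge> T" "u \<in> {1..2}" for t u
  proof -
    have "1 * t \<le> u * t" using that T(1) by (intro mult_right_mono) auto
    then have "\<phi> t > 0" "\<phi> (u * t) > 0" "u > 0" "\<bar>ln (\<phi> (u * t) / \<phi> t) - b_min * ln u\<bar> \<le> e"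
      using that pos T1[of t u] by (auto simp: T_def)
    from \<phi>_bounds[OF this]
    show "\<phi> (u * t) \<le> exp e * u powr b_min * \<phi> t"
      "\<phi> t \<le> exp e * u powr (- b_min) * \<phi> (u * t)" .
  qed
  have half_powr: "(1 / 2) powr a = 2 powr (- a)" for a :: real
    by (simp add: powr_divide powr_minus_divide)
  show ?thesis
  proof (rule that[OF T pos])
    fix t x :: real assume t: "t \<ge> T" and x: "1 \<le> x"
    obtain y k where y: "y \<in> {1..2}" and xy: "x = y * 2 ^ k"
      using dyadic_decomposition[OF x] by metis
    have "norm (err (y * 2 ^ k) t) \<le> \<kappa> * (y * 2 ^ k) powr (b_max + \<epsilon>) * \<phi> t"
    proof (rule geometric_iteration[where r = err and \<phi> = \<phi> and q = 2 and S = "{1..2}" and T = T and C = C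
            and P = "\<lambda>x. (*v) (matrix_powr x B)" and \<delta> = \<delta> and \<theta> = \<theta>])
      show "err (x * 2) t = err x (2 * t) + matrix_powr x B *v err 2 t" if "x > 0" for x t
        using that by (rule err_mult) simp
      show "norm (matrix_powr (y * 2 ^ k) B *v v) \<le> C * (y * 2 ^ k) powr (b_max + \<epsilon>) * norm v"
        if "y \<in> {1..2}" for y k v
        using that mult_mono[of 1 y 1 "2 ^ k"] by (intro C(2)) auto
      show "norm (err y t) \<le> \<kappa> * y powr (b_max + \<epsilon>) * \<phi> t" if "y \<in> {1..2}" "t \<ge> T" for y t
      proof -
        have "norm (err y t) \<le> \<delta> * \<phi> t" using that by (intro err_small)
        also have "\<dots> \<le> \<kappa> * y powr (b_max + \<epsilon>) * \<phi> t"
          using that pos[of t] \<delta>_max m_base[of y "b_max + \<epsilon>"] by (intro mult_right_mono) auto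
        finally show ?thesis .
      qed
      show "norm (err 2 t) \<le> \<delta> * \<phi> t" if "t \<ge> T" for t
        using that by (intro err_small) auto
      show "\<phi> (2 * t) \<le> \<theta> * 2 powr (b_max + \<epsilon>) * \<phi> t" if "t \<ge> T" for t
      proof -
        have "\<phi> (2 * t) \<le> exp e * 2 powr b_min * \<phi> t"
          using that by (intro \<phi>_up) auto
        also have "exp e * 2 powr b_min = 2 powr (\<epsilon> / 2 + b_min)"
          by (simp add: e(2) powr_add)
        \<comment> \<open>Both exponents contain a net \<open>\<epsilon> / 2\<close>, so the
          comparison is \<open>b_min \<le> b_max\<close>.\<close>
        also have "\<dots> \<le> 2 powr (- \<epsilon> / 2 + (b_max + \<epsilon>))"
          using diag[of first_ix last_ix] by (intro powr_mono) auto
        also have "\<dots> = \<theta> * 2 powr (b_max + \<epsilon>)"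
          by (simp only: \<theta>_def powr_add)
        finally show ?thesis using pos[OF that] by simp
      qed
      show "\<kappa> * \<theta> * 2 powr (b_max + \<epsilon>) + C * \<delta> \<le> \<kappa> * 2 powr (b_max + \<epsilon>)"
        by (rule m_step[OF _ _ \<delta>_max]) auto
      have "1 * t \<le> x * t" using t T(1) x by (intro mult_right_mono) auto
      then show "y * 2 ^ k * t \<ge> T" using t by (simp add: xy)
      show "2 * t \<ge> T" if "t \<ge> T" for t using that T(1) by simp
    qed (use \<kappa> C(1) y t pos in \<open>auto intro: less_imp_le\<close>)
    then show "norm (err x t) \<le> \<kappa> * x powr (b_max + \<epsilon>) * \<phi> t"
      by (simp add: xy)
  next
    fix t x :: real assume t: "t \<ge> T" and x: "0 < x" "x \<le> 1" and xt: "x * t \<ge> T"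
    \<comment> \<open>Decomposing \<open>1 / x\<close> and inverting gives
      \<open>x = y * (1 / 2) ^ k\<close> with \<open>y\<close> in \<open>{1 / 2..1}\<close>.\<close>
    obtain y' k where y': "y' \<in> {1..2}" and xy': "1 / x = y' * 2 ^ k"
      using dyadic_decomposition[of "1 / x"] x by auto
    define y where "y = 1 / y'"
    have y: "y \<in> {1 / 2..1}" using y' by (auto simp: y_def field_simps)
    have xy: "x = y * (1 / 2) ^ k"
      using xy' x y' by (simp add: y_def field_simps)
    have inv_t: "(1 / y) * (y * t) = t" "1 / y \<in> {1..2}" if "y \<in> {1 / 2..1}" for y t :: real
      using that by (auto simp: field_simps)
    have base: "norm (err y t) \<le> C1 * L * \<delta> * \<phi> t" if y: "y \<in> {1 / 2..1}" and t: "y * t \<ge> T" for y t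
    proof -
      \<comment> \<open>Going down from \<open>t\<close> to \<open>y * t\<close> and back up leaves
        \<open>err 1 (y * t) = 0\<close>, so the downward error is minus the transported upward
        error at \<open>y * t\<close>.\<close>
      have "err y t + matrix_powr y B *v err (1 / y) (y * t) = err (y * (1 / y)) (y * t)"
        using y inv_t(1)[OF y] by (subst err_mult) auto
      also have "\<dots> = 0" using y by (simp add: err_def)
      finally have "err y t = - (matrix_powr y B *v err (1 / y) (y * t))"
        by (simp add: eq_neg_iff_add_eq_0)
      then have "norm (err y t) \<le> C1 * norm (err (1 / y) (y * t))"
        using C1(2)[of y] y by simp
      also have "\<dots> \<le> C1 * (\<delta> * \<phi> (y * t))"
        using C1(1) y t inv_t(2) by (intro mult_left_mono err_small) auto
      also have "\<dots> \<le> C1 * (\<delta> * (L * \<phi> t))"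
      proof (intro mult_left_mono)
        have "\<phi> (y * t) \<le> exp e * (1 / y) powr (- b_min) * \<phi> t"
          using \<phi>_down[OF t inv_t(2)[OF y]] inv_t(1)[OF y] by simp
        also have "\<dots> \<le> L * \<phi> t"
          unfolding L_def using inv_t(2)[OF y] powr_between_half_and_two(1)[of "1 / y" "- b_min"]
          by (intro mult_right_mono mult_left_mono) (auto simp: \<phi>_def)
        finally show "\<phi> (y * t) \<le> L * \<phi> t" .
      qed (use C1(1) \<delta>_pos in auto)
      finally show ?thesis by (simp add: mult_ac)
    qed
    have "norm (err (y * (1 / 2) ^ k) t) \<le> \<kappa> * (y * (1 / 2) ^ k) powr (b_min - \<epsilon>) * \<phi> t"
    proof (rule geometric_iteration[where r = err and \<phi> = \<phi> and q = "1 / 2" and S = "{1 / 2..1}" and T = T and C = C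
            and P = "\<lambda>x. (*v) (matrix_powr x B)" and \<delta> = "C1 * L * \<delta>" and \<theta> = \<theta>])
      show "err (x * (1 / 2)) t = err x (1 / 2 * t) + matrix_powr x B *v err (1 / 2) t"
        if "x > 0" for x t
        using that by (rule err_mult) simp
      show "norm (matrix_powr (y * (1 / 2) ^ k) B *v v)
          \<le> C * (y * (1 / 2) ^ k) powr (b_min - \<epsilon>) * norm v" if "y \<in> {1 / 2..1}" for y k v
        using that by (intro C(3) mult_pos_pos mult_le_one power_le_one) auto
      show "norm (err y t) \<le> \<kappa> * y powr (b_min - \<epsilon>) * \<phi> t"
        if y: "y \<in> {1 / 2..1}" and t: "t \<ge> T" "y * t \<ge> T" for y t
      proof -
        have "norm (err y t) \<le> C1 * L * \<delta> * \<phi> t" using y t(2) by (rule base)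
        also have "\<dots> \<le> \<kappa> * y powr (b_min - \<epsilon>) * \<phi> t"
          using y pos[OF t(1)] order_trans[OF \<delta>_m(2) m_base[of y "b_min - \<epsilon>"]]
          by (intro mult_right_mono) auto
        finally show ?thesis .
      qed
      show "norm (err (1 / 2) t) \<le> C1 * L * \<delta> * \<phi> t" if "1 / 2 * t \<ge> T" for t
        using that by (intro base) auto
      show "\<phi> (1 / 2 * t) \<le> \<theta> * (1 / 2) powr (b_min - \<epsilon>) * \<phi> t" if "1 / 2 * t \<ge> T" for t
      proof -
        have "\<phi> (1 / 2 * t) \<le> exp e * 2 powr (- b_min) * \<phi> (2 * (1 / 2 * t))"
          using that by (intro \<phi>_down) auto
        also have "exp e * 2 powr (- b_min) = \<theta> * (1 / 2) powr (b_min - \<epsilon>)"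
          by (simp add: e(2) \<theta>_def half_powr flip: powr_add)
        finally show ?thesis by simp
      qed
      show "\<kappa> * \<theta> * (1 / 2) powr (b_min - \<epsilon>) + C * (C1 * L * \<delta>) \<le> \<kappa> * (1 / 2) powr (b_min - \<epsilon>)"
        by (rule m_step[OF _ _ \<delta>_m(2)]) auto
      show "1 / 2 * t \<ge> T" if y: "y \<in> {1 / 2..1}" and t: "t \<ge> T" "y * (1 / 2) ^ Suc k * t \<ge> T" for y k t
      proof -
        \<comment> \<open>The full descent ends above \<open>T\<close> and the remaining factor is
          at most \<open>1\<close>, so the first halving is already above \<open>T\<close>.\<close>
        have "y * (1 / 2) ^ k * (1 / 2 * t) \<le> 1 * (1 / 2 * t)"
          using y t(1) T(1) by (intro mult_right_mono mult_le_one power_le_one) auto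
        then show ?thesis using t(2) by simp
      qed
      show "y * (1 / 2) ^ k * t \<ge> T" using xt by (simp add: xy)
    qed (use \<kappa> C(1) y t pos in \<open>auto intro: less_imp_le\<close>)
    then show "norm (err x t) \<le> \<kappa> * x powr (b_min - \<epsilon>) * \<phi> t"
      by (simp add: xy)
  qed
qed

end

text \<open>Expansion in the standard basis, with each coordinate bounded by the Euclidean norm;
  \<open>K\<close> is essentially the sum of \<open>N\<close> over the basis vectors.\<close>

lemma is_norm_le_norm:
  fixes N :: "real ^ 'n \<Rightarrow> real"
  assumes "is_norm N"
  obtains K where "K > 0" "\<And>v. N v \<le> K * norm v"
proof -
  have scale: "N (c *\<^sub>R x) = \<bar>c\<bar> * N x" and tri: "N (x + y) \<le> N x + N y"
    and nonneg: "N x \<ge> 0" for c x y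
    using assms by (auto simp: is_norm_def)
  have N0: "N 0 = 0" using assms by (auto simp: is_norm_def)
  have sum: "N (\<Sum>i\<in>A. f i) \<le> (\<Sum>i\<in>A. N (f i))" if "finite A" for A and f :: "'n \<Rightarrow> real ^ 'n"
    using that by (induction A rule: finite_induct) (auto simp: N0 intro: order_trans[OF tri])
  define K where "K = (\<Sum>i\<in>UNIV. N (axis i 1))"
  have K0: "K \<ge> 0" unfolding K_def by (intro sum_nonneg nonneg)
  have "N v \<le> K * norm v" for v
  proof -
    have "N (\<Sum>i\<in>UNIV. v $ i *\<^sub>R axis i 1) \<le> (\<Sum>i\<in>UNIV. N (v $ i *\<^sub>R axis i 1))"
      by (rule sum) simp
    then have "N v \<le> (\<Sum>i\<in>UNIV. N (v $ i *\<^sub>R axis i 1))"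
      using basis_expansion[of v] by (simp add: scalar_mult_eq_scaleR)
    also have "\<dots> \<le> (\<Sum>i\<in>UNIV. N (axis i 1) * norm v)"
      unfolding scale
      by (intro sum_mono, subst mult.commute, intro mult_left_mono component_le_norm_cart nonneg)
    also have "\<dots> = K * norm v" by (simp add: K_def sum_distrib_right)
    finally show ?thesis .
  qed
  \<comment> \<open>Adding \<open>1\<close> makes the constant strictly positive at once, so that it
    can be divided by later.\<close>
  then have "N v \<le> (K + 1) * norm v" for v
    using mult_right_mono[of K "K + 1" "norm v"] order_trans by fastforce
  then show ?thesis using K0 by (intro that[of "K + 1"]) auto
qed

theorem theorem4p6:
  fixes B :: "real ^ 'n::{finite,linorder} ^ 'n::{finite,linorder}"
    and g :: "real \<Rightarrow> real ^ 'n::{finite,linorder}"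
    and D :: "real set"
    and N :: "real ^ 'n::{finite,linorder} \<Rightarrow> real"
    and \<epsilon> :: real
  assumes "is_norm N"
    and "index_matrix B"
    and "regularly_varying B D g"
    and "\<epsilon> > 0"
  shows "\<exists>T>0. {T..} \<subseteq> D \<and> (\<forall>t\<ge>T. g t $ last_ix \<noteq> 0) \<and>
    (\<forall>t\<ge>T.
      (\<forall>x\<ge>1. N (g (x * t) - matrix_powr x B *v g t) / \<bar>g t $ last_ix\<bar>
                \<le> \<epsilon> * x powr (B $ first_ix $ first_ix + \<epsilon>)) \<and>
      (\<forall>x. T / t \<le> x \<and> x \<le> 1 \<longrightarrow>
              N (g (x * t) - matrix_powr x B *v g t) / \<bar>g t $ last_ix\<bar>
                \<le> \<epsilon> * x powr (B $ last_ix $ last_ix - \<epsilon>)))"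
proof -
  interpret regularly_varying_vector B D g
    using assms(2,3) by unfold_locales (auto simp: index_matrix_def)
  obtain K where K: "K > 0" "\<And>v. N v \<le> K * norm v"
    using is_norm_le_norm[OF assms(1)] by metis
  obtain T where T: "T > 0" "{T..} \<subseteq> D" and pos: "\<And>t. t \<ge> T \<Longrightarrow> \<phi> t > 0"
    and up: "\<And>t x. t \<ge> T \<Longrightarrow> 1 \<le> x \<Longrightarrow> norm (err x t) \<le> \<epsilon> / K * x powr (b_max + \<epsilon>) * \<phi> t"
    and down: "\<And>t x. t \<ge> T \<Longrightarrow> 0 < x \<Longrightarrow> x \<le> 1 \<Longrightarrow> x * t \<ge> T
        \<Longrightarrow> norm (err x t) \<le> \<epsilon> / K * x powr (b_min - \<epsilon>) * \<phi> t"
    \<comment> \<open>The tolerance \<open>\<epsilon> / K\<close> absorbs the constant from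
      comparing \<open>N\<close> with the Euclidean norm.\<close>
    by (rule potter[of "\<epsilon> / K" \<epsilon>]) (use K assms(4) in auto)
  have bound: "N (g (x * t) - matrix_powr x B *v g t) / \<bar>g t $ last_ix\<bar> \<le> \<epsilon> * y"
    if "t \<ge> T" "norm (err x t) \<le> \<epsilon> / K * y * \<phi> t" for x t y
  proof -
    have "N (err x t) \<le> K * (\<epsilon> / K * y * \<phi> t)"
      using K that(2) by (meson mult_left_mono less_imp_le order_trans)
    then have "N (err x t) / \<phi> t \<le> \<epsilon> * y"
      using K(1) pos[OF that(1)] by (simp add: field_simps)
    then show ?thesis by (simp add: err_def \<phi>_def)
  qed
  show ?thesis
  proof (intro exI[of _ T] conjI allI impI T)
    show "g t $ last_ix \<noteq> 0" if "t \<ge> T" for t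
      using pos[OF that] by (auto simp: \<phi>_def)
  next
    fix t x :: real assume "t \<ge> T" "1 \<le> x"
    then show "N (g (x * t) - matrix_powr x B *v g t) / \<bar>g t $ last_ix\<bar> \<le> \<epsilon> * x powr (b_max + \<epsilon>)"
      by (intro bound up)
  next
    fix t x :: real assume t: "t \<ge> T" and x: "T / t \<le> x \<and> x \<le> 1"
    have "t > 0" using t T(1) by simp
    then have "T \<le> x * t" using x by (simp add: field_simps)
    moreover have "0 < T / t" using \<open>t > 0\<close> T(1) by simp
    then have "0 < x" using x by linarith
    ultimately show "N (g (x * t) - matrix_powr x B *v g t) / \<bar>g t $ last_ix\<bar> \<le> \<epsilon> * x powr (b_min - \<epsilon>)"
      using t x by (intro bound down) auto
  qed
qed

end
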